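(* Let $\mathcal{H}$ be a real Hilbert space, let $n\in\mathbb{N}\smallsetminus\{0\}$ and $m=2n-1$. Let $U_1,\ldots,U_n$ be closed linear subspaces of $\mathcal{H}$ with $U_1^\perp+\cdots+U_n^\perp$ closed, and set $U_{n+i}:=U_{n-i}$ for every $i\in\{1,\ldots,n-1\}$. Let $\mathcal{S}$ be a finite set of operators with $\Psi\subseteq\mathcal{S}\subseteq\Omega$, where $$\Omega=\{\mathrm{R}_{U_{i_r}}\cdots\mathrm{R}_{U_{i_2}}\mathrm{R}_{U_{i_1}} : r\in\mathbb{N},\ i_1,\ldots,i_r\in\{1,\ldots,m\}\},$$ $$\Psi=\{\mathrm{R}_{U_{i_r}}\cdots\mathrm{R}_{U_{i_2}}\mathrm{R}_{U_{i_1}} : r\in\{0,1,\ldots,m\},\ i_1,\ldots,i_r\in\{1,\ldots,m\},\ i_1<\cdots<i_r\}.$$ Set $\gamma:=\|\mathrm{P}_{U_n}\mathrm{P}_{U_{n-1}}\cdots\mathrm{P}_{U_1}\mathrm{P}_{(\cap_{i=1}^nU_i)^\perp}\|$. Then $\gamma\in[0,1[$ and, for every $x\in\mathcal{H}$ and every $k\in\mathbb{N}$, $$\|CC_{\mathcal{S}}^kx-\mathrm{P}_{\cap_{i=1}^nU_i}x\|\le\gamma^{2k}\,\|x-\mathrm{P}_{\cap_{i=1}^nU_i}x\|,$$ that is, $(CC_{\mathcal{S}}^kx)_{k\in\mathbb{N}}$ converges to $\mathrm{P}_{\cap_{i=1}^nU_i}x$ with linear rate $\gamma^2$.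
   Context: $\mathbb{N}=\{0,1,2,\ldots\}$, and $\gamma^0=1$ also for $\gamma=0$. $\mathrm{P}_C$ is the projector (best approximation operator) onto $C$, and $\mathrm{R}_C=2\mathrm{P}_C-\mathrm{Id}$ is the reflector associated with $C$. The empty composition ($r=0$) is $\mathrm{Id}$. $C^\perp$ is the orthogonal complement; $\|\cdot\|$ of a bounded linear operator is the operator norm. Circumcenter mapping: for a finite set $\mathcal{S}$ of isometries of $\mathcal{H}$ having a common fixed point (such as a finite subset of $\Omega$), and $x\in\mathcal{H}$, let $\mathcal{S}(x)=\{Tx: T\in\mathcal{S}\}$. It is known that there is a unique point $CC_{\mathcal{S}}(x)$ that lies in the affine hull $\operatorname{aff}(\mathcal{S}(x))$ and is equidistant from all points of $\mathcal{S}(x)$; this defines the circumcenter mapping $CC_{\mathcal{S}}:\mathcal{H}\to\mathcal{H}$. $CC_{\mathcal{S}}^k$ is its $k$-fold composition. *)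

theory Defs
  imports "HOL-Analysis.Analysis"
begin

text \<open>A real Hilbert space is a type of sort \<open>{real_inner, complete_space}\<close>. The library's
  \<open>closest_point\<close> is restricted to \<open>heine_borel\<close> types, that is, to finite dimension;
  \<open>projector\<close> is the best approximation operator without that restriction. It is well defined
  when \<open>C\<close> is nonempty, closed and convex.\<close>

definition projector :: "'a::{real_inner,complete_space} set \<Rightarrow> 'a \<Rightarrow> 'a"
  where "projector C x = (THE p. p \<in> C \<and> (\<forall>y\<in>C. dist x p \<le> dist x y))"

definition reflector :: "'a::{real_inner,complete_space} set \<Rightarrow> 'a \<Rightarrow> 'a"
  where "reflector C x = 2 *\<^sub>R projector C x - x"

text \<open>\<open>compose_ops [T\<^sub>1, \<dots>, T\<^sub>r] = T\<^sub>r \<circ> \<dots> \<circ> T\<^sub>1\<close>: the head of the list is applied first.\<close>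

definition compose_ops :: "('a \<Rightarrow> 'a) list \<Rightarrow> 'a \<Rightarrow> 'a"
  where "compose_ops Ts = fold (\<circ>) Ts id"

definition Omega_ops :: "nat \<Rightarrow> (nat \<Rightarrow> 'a::{real_inner,complete_space} set) \<Rightarrow> ('a \<Rightarrow> 'a) set"
  where "Omega_ops m U =
    {compose_ops (map (\<lambda>i. reflector (U i)) is) | is. set is \<subseteq> {1..m}}"

definition Psi_ops :: "nat \<Rightarrow> (nat \<Rightarrow> 'a::{real_inner,complete_space} set) \<Rightarrow> ('a \<Rightarrow> 'a) set"
  where "Psi_ops m U =
    {compose_ops (map (\<lambda>i. reflector (U i)) is) | is.
      length is \<le> m \<and> set is \<subseteq> {1..m} \<and> sorted_wrt (<) is}"

text \<open>The circumcenter is well defined when \<open>S\<close> is a nonempty finite set of isometries with a common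
  fixed point.\<close>

definition circumcenter_map :: "('a::{real_inner,complete_space} \<Rightarrow> 'a) set \<Rightarrow> 'a \<Rightarrow> 'a"
  where "circumcenter_map S x =
    (THE p. p \<in> affine hull ((\<lambda>T. T x) ` S) \<and> (\<forall>T\<in>S. \<forall>T'\<in>S. dist p (T x) = dist p (T' x)))"

end

theory Submission
  imports Defs
begin

text \<open>Write \<open>L = \<Inter>U\<^sub>i\<close> and \<open>A = P\<^sub>U\<^sub>n \<dots> P\<^sub>U\<^sub>1\<close>. Every operator in \<open>S\<close> is a linear isometry that fixes
  \<open>L\<close> pointwise. Hence \<open>P\<^sub>L x\<close> is equidistant from the points \<open>T x\<close> with \<open>T \<in> S\<close>, and the
  circumcenter of these points is the orthogonal projection of \<open>P\<^sub>L x\<close> onto their affine hull: one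
  circumcenter step ends at least as close to \<open>P\<^sub>L x\<close> as any other point of the hull
  (\<open>circumcenter_map_nearest\<close>), and it keeps the projection onto \<open>L\<close>
  (\<open>projector_circumcenter_map\<close>). Each projector is the mean of the identity and a reflector, so the
  palindromic product \<open>P\<^sub>U\<^sub>1 \<dots> P\<^sub>U\<^sub>n \<dots> P\<^sub>U\<^sub>1 = A\<^sup>* A\<close> maps \<open>x\<close> into the affine hull of the points \<open>T x\<close>
  with \<open>T\<close> in \<open>\<Psi>\<close> (\<open>projector_product_in_affine_hull_Psi\<close>). On \<open>L\<^sup>\<bottom>\<close>, which \<open>A\<^sup>* A\<close> preserves, its norm
  is at most \<open>\<gamma>\<^sup>2\<close>, and the rate follows by iteration.

  That \<open>\<gamma> < 1\<close> is where the closedness of \<open>\<Sum>U\<^sub>i\<^sup>\<bottom>\<close> enters. It makes this sum all of \<open>L\<^sup>\<bottom>\<close>, and a uniform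
  boundedness argument then yields a constant \<open>C\<close> such that the norm of each \<open>x \<in> L\<^sup>\<bottom>\<close> is at most \<open>C\<close>
  times the largest of its distances to the \<open>U\<^sub>i\<close> (\<open>linear_regularity\<close>). These distances are in turn
  controlled by the norm that \<open>A\<close> loses at \<open>x\<close> (\<open>projector_product_residual\<close>), so \<open>A\<close> must lose a
  fixed proportion of it.\<close>

section \<open>Orthogonal projections onto closed subspaces\<close>

text \<open>A minimizing sequence for the distance from \<open>x\<close> to \<open>V\<close> is Cauchy by the parallelogram law:
  the midpoint of two almost minimizers cannot be much closer to \<open>x\<close> than they are.\<close>

lemma nearest_point_exists:
  fixes V :: "'a::{real_inner,complete_space} set"
  assumes "closed V" and "subspace V"
  shows "\<exists>p\<in>V. \<forall>v\<in>V. norm (x - p) \<le> norm (x - v)"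
proof -
  define d where "d = infdist x V"
  have V0: "0 \<in> V" using assms(2) by (rule subspace_0)
  have d0: "0 \<le> d" by (simp add: d_def infdist_nonneg)
  have dle: "d \<le> norm (x - v)" if "v \<in> V" for v
    using infdist_le[OF that, of x] by (simp add: d_def dist_norm)
  have "\<exists>v\<in>V. norm (x - v) < d + e" if "e > 0" for e
  proof (rule ccontr)
    assume "\<not> ?thesis"
    then have "d + e \<le> dist x v" if "v \<in> V" for v using that by (auto simp: dist_norm not_less)
    then have "d + e \<le> infdist x V"
      using V0 by (auto simp: infdist_def intro!: cINF_greatest)
    then show False using that by (simp add: d_def)
  qed
  then have "\<forall>k. \<exists>v\<in>V. norm (x - v) < d + inverse (real (Suc k))" by simp
  then obtain p where pV: "\<And>k. p k \<in> V" and p: "\<And>k. norm (x - p k) < d + inverse (real (Suc k))"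
    by metis
  have lim: "(\<lambda>k. norm (x - p k)) \<longlonglongrightarrow> d"
  proof (rule tendsto_sandwich)
    show "\<forall>\<^sub>F k in sequentially. d \<le> norm (x - p k)" using pV dle by simp
    show "\<forall>\<^sub>F k in sequentially. norm (x - p k) \<le> d + inverse (real (Suc k))"
      using p by (simp add: less_imp_le)
    show "(\<lambda>k. d + inverse (real (Suc k))) \<longlonglongrightarrow> d"
      using tendsto_add[OF tendsto_const LIMSEQ_inverse_real_of_nat, of d] by simp
  qed simp
  then have lim2: "(\<lambda>k. (norm (x - p k))\<^sup>2) \<longlonglongrightarrow> d\<^sup>2" by (rule tendsto_power)
  have par: "(norm (p i - p j))\<^sup>2 \<le> 2 * (norm (x - p i))\<^sup>2 + 2 * (norm (x - p j))\<^sup>2 - 4 * d\<^sup>2" for i j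
  proof -
    have "(1/2) *\<^sub>R (p i + p j) \<in> V"
      using assms(2) pV by (intro subspace_scale subspace_add) auto
    then have "d\<^sup>2 \<le> (norm (x - (1/2) *\<^sub>R (p i + p j)))\<^sup>2"
      using dle d0 by (intro power_mono) auto
    moreover have "4 * (norm (x - (1/2) *\<^sub>R (p i + p j)))\<^sup>2 + (norm (p i - p j))\<^sup>2
        = 2 * (norm (x - p i))\<^sup>2 + 2 * (norm (x - p j))\<^sup>2"
      by (simp add: power2_norm_eq_inner algebra_simps inner_commute)
    ultimately show ?thesis by simp
  qed
  have "Cauchy p"
  proof (rule metric_CauchyI)
    fix e :: real assume "e > 0"
    then have "\<forall>\<^sub>F k in sequentially. (norm (x - p k))\<^sup>2 < d\<^sup>2 + e\<^sup>2 / 4"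
      by (intro order_tendstoD(2)[OF lim2]) simp
    then obtain N where N: "\<And>k. k \<ge> N \<Longrightarrow> (norm (x - p k))\<^sup>2 < d\<^sup>2 + e\<^sup>2 / 4"
      by (auto simp: eventually_sequentially)
    have "dist (p i) (p j) < e" if "i \<ge> N" "j \<ge> N" for i j
    proof -
      have "(norm (p i - p j))\<^sup>2 < e\<^sup>2"
        using par[of i j] N[OF that(1)] N[OF that(2)] by simp
      then show ?thesis using \<open>e > 0\<close> by (simp add: dist_norm power_less_imp_less_base)
    qed
    then show "\<exists>M. \<forall>i\<ge>M. \<forall>j\<ge>M. dist (p i) (p j) < e" by blast
  qed
  then obtain q where q: "p \<longlonglongrightarrow> q" using Cauchy_convergent convergent_def by blast
  have "q \<in> V" using closed_sequentially[OF assms(1) pV q] .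
  moreover have "norm (x - q) = d"
    using LIMSEQ_unique[OF tendsto_norm[OF tendsto_diff[OF tendsto_const q]] lim] .
  ultimately show ?thesis using dle by auto
qed

lemma orthogonal_projection_exists:
  fixes V :: "'a::{real_inner,complete_space} set"
  assumes "closed V" and "subspace V"
  obtains p where "p \<in> V" "\<And>v. v \<in> V \<Longrightarrow> (x - p) \<bullet> v = 0"
proof -
  obtain p where p: "p \<in> V" "\<And>v. v \<in> V \<Longrightarrow> norm (x - p) \<le> norm (x - v)"
    using nearest_point_exists[OF assms] by blast
  have "(x - p) \<bullet> v = 0" if v: "v \<in> V" for v
  proof (cases "v = 0")
    case False
    \<comment> \<open>\<open>p + t v\<close> is the point nearest to \<open>x\<close> on the line through \<open>p\<close> in the direction \<open>v\<close>.\<close>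
    define t where "t = ((x - p) \<bullet> v) / (v \<bullet> v)"
    have "p + t *\<^sub>R v \<in> V" using p v assms(2) by (simp add: subspace_add subspace_scale)
    then have "(norm (x - p))\<^sup>2 \<le> (norm (x - (p + t *\<^sub>R v)))\<^sup>2"
      using p(2) by (intro power_mono) auto
    also have "\<dots> = (norm (x - p))\<^sup>2 - 2 * t * ((x - p) \<bullet> v) + t * t * (v \<bullet> v)"
      unfolding power2_norm_eq_inner by (simp add: inner_commute algebra_simps)
    also have "\<dots> = (norm (x - p))\<^sup>2 - ((x - p) \<bullet> v)\<^sup>2 / (v \<bullet> v)"
      using False by (simp add: t_def field_simps power2_eq_square)
    finally have "((x - p) \<bullet> v)\<^sup>2 / (v \<bullet> v) \<le> 0" by simp
    moreover have "v \<bullet> v > 0" using False by simp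
    ultimately have "((x - p) \<bullet> v)\<^sup>2 \<le> 0" by (simp add: divide_le_0_iff)
    then show ?thesis by simp
  qed simp
  with p show ?thesis using that by blast
qed

lemma projector_eqI:
  assumes "subspace V" and "p \<in> V" and orth: "\<And>v. v \<in> V \<Longrightarrow> (x - p) \<bullet> v = 0"
  shows "projector V x = p"
  unfolding projector_def
proof (rule the_equality)
  have pyth: "(dist x v)\<^sup>2 = (dist x p)\<^sup>2 + (dist p v)\<^sup>2" if "v \<in> V" for v
  proof -
    have "(x - p) \<bullet> (p - v) = 0" using orth assms that by (simp add: subspace_diff)
    then show ?thesis
      unfolding dist_norm power2_norm_eq_inner by (simp add: inner_commute algebra_simps)
  qed
  have "dist x p \<le> dist x v" if "v \<in> V" for v
    by (rule power2_le_imp_le) (use pyth[OF that] in auto)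
  then show "p \<in> V \<and> (\<forall>y\<in>V. dist x p \<le> dist x y)" using assms by blast
  fix q assume q: "q \<in> V \<and> (\<forall>y\<in>V. dist x q \<le> dist x y)"
  then have "(dist x q)\<^sup>2 \<le> (dist x p)\<^sup>2" using assms by (intro power_mono) auto
  then show "q = p" using pyth[of q] q by simp
qed

context
  fixes V :: "'a::{real_inner,complete_space} set"
  assumes closed: "closed V" and subspace: "subspace V"
begin

lemma projector_props: "projector V x \<in> V \<and> (\<forall>v\<in>V. (x - projector V x) \<bullet> v = 0)"
proof -
  obtain p where "p \<in> V" "\<And>v. v \<in> V \<Longrightarrow> (x - p) \<bullet> v = 0"
    using orthogonal_projection_exists[OF closed subspace] by blast
  then show ?thesis using projector_eqI[OF subspace] by simp
qed

lemma projector_mem: "projector V x \<in> V"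
  using projector_props by blast

lemma projector_residual_orthogonal: "v \<in> V \<Longrightarrow> (x - projector V x) \<bullet> v = 0"
  using projector_props by blast

lemma projector_fixes: "x \<in> V \<Longrightarrow> projector V x = x"
  by (rule projector_eqI[OF subspace]) auto

lemma linear_projector: "linear (projector V)"
proof (rule linearI)
  fix x y :: 'a and r :: real
  show "projector V (x + y) = projector V x + projector V y"
  proof (rule projector_eqI[OF subspace])
    show "projector V x + projector V y \<in> V" by (simp add: subspace subspace_add projector_mem)
    fix v assume "v \<in> V"
    then show "(x + y - (projector V x + projector V y)) \<bullet> v = 0"
      using projector_residual_orthogonal[of v x] projector_residual_orthogonal[of v y]
      by (simp add: algebra_simps)
  qed
  show "projector V (r *\<^sub>R x) = r *\<^sub>R projector V x"
  proof (rule projector_eqI[OF subspace])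
    show "r *\<^sub>R projector V x \<in> V" by (simp add: subspace subspace_scale projector_mem)
    fix v assume "v \<in> V"
    then have "r * ((x - projector V x) \<bullet> v) = 0"
      using projector_residual_orthogonal[of v x] by simp
    then show "(r *\<^sub>R x - r *\<^sub>R projector V x) \<bullet> v = 0"
      by (simp add: algebra_simps)
  qed
qed

lemma projector_self_adjoint: "projector V x \<bullet> y = x \<bullet> projector V y"
  using projector_residual_orthogonal[OF projector_mem, of x y]
    projector_residual_orthogonal[OF projector_mem, of y x]
  by (simp add: algebra_simps inner_commute)

lemma projector_Pythagoras: "(norm (projector V x))\<^sup>2 + (norm (x - projector V x))\<^sup>2 = (norm x)\<^sup>2"
  using projector_residual_orthogonal[OF projector_mem, of x x]
  by (simp add: power2_norm_eq_inner algebra_simps inner_commute)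

lemma norm_projector_le: "norm (projector V x) \<le> norm x"
  by (rule power2_le_imp_le) (use projector_Pythagoras[of x] zero_le_power2[of "norm (x - projector V x)"] in linarith, simp)

lemma projector_nearest: "v \<in> V \<Longrightarrow> norm (x - projector V x) \<le> norm (x - v)"
proof -
  assume "v \<in> V"
  have "(x - projector V x) \<bullet> (projector V x - v) = 0"
    by (simp add: \<open>v \<in> V\<close> subspace subspace_diff projector_mem projector_residual_orthogonal)
  then have "(norm (x - v))\<^sup>2 = (norm (x - projector V x))\<^sup>2 + (norm (projector V x - v))\<^sup>2"
    unfolding power2_norm_eq_inner by (simp add: inner_commute algebra_simps)
  then show ?thesis by (auto intro: power2_le_imp_le)
qed

lemma bounded_linear_projector: "bounded_linear (projector V)"
  using linear_projector norm_projector_le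
  by (auto simp: bounded_linear_def bounded_linear_axioms_def intro!: exI[of _ 1])

lemma projector_residual_mem: "x - projector V x \<in> V\<^sup>\<bottom>"
  using projector_residual_orthogonal by (auto simp: orthogonal_comp_def orthogonal_def inner_commute)

lemma projector_orthogonal_comp: "projector (V\<^sup>\<bottom>) x = x - projector V x"
proof (rule projector_eqI[OF subspace_orthogonal_comp])
  show "x - projector V x \<in> V\<^sup>\<bottom>" by (rule projector_residual_mem)
  fix v assume "v \<in> V\<^sup>\<bottom>"
  then show "(x - (x - projector V x)) \<bullet> v = 0"
    using projector_mem by (auto simp: orthogonal_comp_def orthogonal_def)
qed

lemma linear_reflector: "linear (reflector V)"
  unfolding reflector_def
  by (intro linear_compose_sub linear_compose_scale_right linear_projector linear_id[unfolded id_def])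

lemma norm_reflector: "norm (reflector V x) = norm x"
proof -
  have "projector V x \<bullet> projector V x = x \<bullet> projector V x"
    using projector_residual_orthogonal[OF projector_mem, of x x] by (simp add: algebra_simps)
  then have "(norm (reflector V x))\<^sup>2 = (norm x)\<^sup>2"
    unfolding reflector_def power2_norm_eq_inner by (simp add: algebra_simps inner_commute)
  then show ?thesis by simp
qed

lemma bounded_linear_reflector: "bounded_linear (reflector V)"
  using linear_reflector norm_reflector
  by (auto simp: bounded_linear_def bounded_linear_axioms_def intro!: exI[of _ 1])

lemma reflector_fixes: "x \<in> V \<Longrightarrow> reflector V x = x"
  by (simp add: reflector_def projector_fixes scaleR_2)

end

section \<open>Linear regularity of subspaces whose complements have a closed sum\<close>

text \<open>The uniform boundedness principle for the functionals \<open>y \<mapsto> x \<bullet> y\<close>: by the Baire category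
  theorem, some set of points \<open>y\<close> at which all of them are bounded by the same \<open>N\<close> contains a ball,
  and moving from the center of the ball in the direction of \<open>x\<close> controls \<open>norm x\<close>.\<close>

lemma weakly_bounded_imp_bounded:
  fixes X :: "'a::{real_inner,complete_space} set"
  assumes "\<And>y. \<exists>B. \<forall>x\<in>X. \<bar>x \<bullet> y\<bar> \<le> B"
  shows "bounded X"
proof -
  define F where "F N = {y. \<forall>x\<in>X. \<bar>x \<bullet> y\<bar> \<le> real N}" for N
  have clF: "closed (F N)" for N
  proof -
    have "F N = (\<Inter>x\<in>X. {y. \<bar>x \<bullet> y\<bar> \<le> real N})" by (auto simp: F_def)
    then show ?thesis by (auto intro!: closed_INT closed_Collect_le continuous_intros)
  qed
  have cover: "\<Union>(range F) = UNIV"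
  proof -
    have "\<exists>N. y \<in> F N" for y
    proof -
      obtain B where B: "\<forall>x\<in>X. \<bar>x \<bullet> y\<bar> \<le> B" using assms by blast
      obtain N where "B \<le> real N" using real_arch_simple by blast
      with B have "y \<in> F N" by (force simp: F_def)
      then show ?thesis by blast
    qed
    then show ?thesis by auto
  qed
  have "\<exists>N. interior (F N) \<noteq> {}"
  proof (rule ccontr)
    assume *: "\<not> ?thesis"
    have "euclidean interior_of \<Union>(range F) = {}"
    proof (rule Baire_category_alt)
      show "completely_metrizable_space (euclidean :: 'a topology) \<or>
          locally_compact_space (euclidean :: 'a topology) \<and> regular_space (euclidean :: 'a topology)"
        by (simp add: completely_metrizable_space_euclidean)
    qed (use * clF in auto)
    then show False by (simp add: cover)
  qed
  then obtain N y where "y \<in> interior (F N)" by blast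
  then obtain r where r: "r > 0" "cball y r \<subseteq> F N" by (auto simp: mem_interior_cball)
  have "norm x \<le> 2 * real N / r" if x: "x \<in> X" for x
  proof (cases "x = 0")
    case False
    have "y + (r / norm x) *\<^sub>R x \<in> cball y r" using r False by (simp add: dist_norm)
    then have "\<bar>x \<bullet> (y + (r / norm x) *\<^sub>R x)\<bar> \<le> real N" using r x by (auto simp: F_def)
    moreover have "y \<in> cball y r" using r by simp
    then have "y \<in> F N" using r by blast
    then have "\<bar>x \<bullet> y\<bar> \<le> real N" using x by (simp add: F_def)
    moreover have "x \<bullet> (y + (r / norm x) *\<^sub>R x) = x \<bullet> y + r * norm x"
      using False by (simp add: inner_add_right power2_norm_eq_inner[symmetric] power2_eq_square)
    ultimately have "r * norm x \<le> 2 * real N" by linarith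
    then show ?thesis using r by (simp add: field_simps)
  qed (use r in simp)
  then show ?thesis by (auto simp: bounded_iff)
qed

text \<open>The sum \<open>M\<close> of the complements is a closed subspace with \<open>M\<^sup>\<bottom> \<subseteq> \<Inter>U\<^sub>i\<close>, so splitting \<open>y\<close> along
  \<open>M\<close> leaves a part that lies in \<open>\<Inter>U\<^sub>i\<close> and is orthogonal to itself.\<close>

lemma orthogonal_comp_Inter_subset_sum:
  fixes U :: "'i \<Rightarrow> 'a::{real_inner,complete_space} set"
  assumes I: "finite I"
    and U: "\<And>i. i \<in> I \<Longrightarrow> closed (U i) \<and> subspace (U i)"
    and cl: "closed (\<Sum>i\<in>I. (U i)\<^sup>\<bottom>)"
  shows "(\<Inter>i\<in>I. U i)\<^sup>\<bottom> \<subseteq> (\<Sum>i\<in>I. (U i)\<^sup>\<bottom>)"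
proof
  fix y assume y: "y \<in> (\<Inter>i\<in>I. U i)\<^sup>\<bottom>"
  let ?M = "\<Sum>i\<in>I. (U i)\<^sup>\<bottom>"
  have M: "?M = {sum s I |s. \<forall>i\<in>I. s i \<in> (U i)\<^sup>\<bottom>}" using set_sum_alt[OF I] .
  have "subspace ?M"
    unfolding subspace_def
  proof (intro conjI ballI allI)
    show "0 \<in> ?M" unfolding M
      by (rule CollectI, rule exI[of _ "\<lambda>i. 0"]) (simp add: subspace_0[OF subspace_orthogonal_comp])
  next
    fix a b assume "a \<in> ?M" "b \<in> ?M"
    then obtain s t where "a = sum s I" "b = sum t I" "\<forall>i\<in>I. s i \<in> (U i)\<^sup>\<bottom>" "\<forall>i\<in>I. t i \<in> (U i)\<^sup>\<bottom>"
      unfolding M by blast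
    then show "a + b \<in> ?M" unfolding M
      by (intro CollectI exI[of _ "\<lambda>i. s i + t i"])
        (simp add: sum.distrib subspace_add[OF subspace_orthogonal_comp])
  next
    fix c :: real and a assume "a \<in> ?M"
    then obtain s where "a = sum s I" "\<forall>i\<in>I. s i \<in> (U i)\<^sup>\<bottom>" unfolding M by blast
    then show "c *\<^sub>R a \<in> ?M" unfolding M
      by (intro CollectI exI[of _ "\<lambda>i. c *\<^sub>R s i"])
        (simp add: scaleR_sum_right subspace_scale[OF subspace_orthogonal_comp])
  qed
  with cl obtain p where p: "p \<in> ?M" "\<And>v. v \<in> ?M \<Longrightarrow> (y - p) \<bullet> v = 0"
    using orthogonal_projection_exists by blast
  \<comment> \<open>\<open>y - p\<close> is orthogonal to \<open>U\<^sub>i\<^sup>\<bottom>\<close>, in particular to its own residual at \<open>U\<^sub>i\<close>.\<close>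
  have yp: "y - p \<in> U i" if i: "i \<in> I" for i
  proof -
    let ?r = "(y - p) - projector (U i) (y - p)"
    have r: "?r \<in> (U i)\<^sup>\<bottom>" using projector_residual_mem[of "U i"] U[OF i] by blast
    have "?r = (\<Sum>j\<in>I. if j = i then ?r else 0)" using I i by simp
    moreover have "\<forall>j\<in>I. (if j = i then ?r else 0) \<in> (U j)\<^sup>\<bottom>"
      using r subspace_0[OF subspace_orthogonal_comp] by auto
    ultimately have "?r \<in> ?M" unfolding M by blast
    then have "(y - p) \<bullet> ?r = 0" by (rule p(2))
    moreover have "projector (U i) (y - p) \<bullet> ?r = 0"
      using projector_residual_orthogonal[of "U i"] projector_mem[of "U i"] U[OF i]
      by (simp add: inner_commute)
    ultimately have "?r \<bullet> ?r = 0" by (subst inner_diff_left) simp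
    then show ?thesis using projector_mem[of "U i"] U[OF i] by (metis inner_eq_zero_iff right_minus_eq)
  qed
  obtain s where s: "p = sum s I" "\<forall>i\<in>I. s i \<in> (U i)\<^sup>\<bottom>" using p(1) unfolding M by blast
  have "(y - p) \<bullet> p = 0" using p by blast
  moreover have "(y - p) \<bullet> y = 0" using y yp by (auto simp: orthogonal_comp_def orthogonal_def)
  ultimately have "(y - p) \<bullet> (y - p) = 0" by (simp add: inner_diff_right)
  then show "y \<in> ?M" using p by simp
qed

text \<open>A decomposition \<open>y = \<Sum>s\<^sub>i\<close> with \<open>s\<^sub>i \<in> U\<^sub>i\<^sup>\<bottom>\<close> turns \<open>x \<bullet> y\<close> into the sum of the products of
  \<open>s\<^sub>i\<close> with the residual of \<open>x\<close> at \<open>U\<^sub>i\<close>. Hence the set of the \<open>x\<close> whose residuals are at most 1 is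
  weakly bounded, and uniform boundedness gives the constant.\<close>

lemma linear_regularity:
  fixes U :: "'i \<Rightarrow> 'a::{real_inner,complete_space} set"
  assumes I: "finite I"
    and U: "\<And>i. i \<in> I \<Longrightarrow> closed (U i) \<and> subspace (U i)"
    and cl: "closed (\<Sum>i\<in>I. (U i)\<^sup>\<bottom>)"
  obtains C where "C > 0"
    "\<And>x t. x \<in> (\<Inter>i\<in>I. U i)\<^sup>\<bottom> \<Longrightarrow> (\<And>i. i \<in> I \<Longrightarrow> norm (x - projector (U i) x) \<le> t) \<Longrightarrow> 0 \<le> t
      \<Longrightarrow> norm x \<le> C * t"
proof -
  let ?L = "\<Inter>i\<in>I. U i"
  define X where "X = {x \<in> ?L\<^sup>\<bottom>. \<forall>i\<in>I. norm (x - projector (U i) x) \<le> 1}"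
  have clL: "closed ?L" and subL: "subspace ?L"
    using U by (auto intro!: closed_INT subspace_Inter)
  have "bounded X"
  proof (rule weakly_bounded_imp_bounded)
    fix y
    have "y - projector ?L y \<in> (\<Sum>i\<in>I. (U i)\<^sup>\<bottom>)"
      using projector_residual_mem[OF clL subL] orthogonal_comp_Inter_subset_sum[OF I U cl] by blast
    then obtain s where s: "y - projector ?L y = sum s I" "\<forall>i\<in>I. s i \<in> (U i)\<^sup>\<bottom>"
      unfolding set_sum_alt[OF I] by blast
    have "\<bar>x \<bullet> y\<bar> \<le> (\<Sum>i\<in>I. norm (s i))" if x: "x \<in> X" for x
    proof -
      have "x \<bullet> projector ?L y = 0"
        using x projector_mem[OF clL subL, of y]
        unfolding X_def orthogonal_comp_def orthogonal_def by (auto simp: inner_commute)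
      then have "x \<bullet> y = x \<bullet> sum s I" by (simp add: s(1)[symmetric] inner_diff_right)
      also have "\<dots> = (\<Sum>i\<in>I. x \<bullet> s i)" by (rule inner_sum_right)
      also have "\<dots> = (\<Sum>i\<in>I. (x - projector (U i) x) \<bullet> s i)"
      proof (rule sum.cong[OF refl])
        fix i assume i: "i \<in> I"
        then have "projector (U i) x \<bullet> s i = 0"
          using s(2) projector_mem[of "U i"] U by (auto simp: orthogonal_comp_def orthogonal_def)
        then show "x \<bullet> s i = (x - projector (U i) x) \<bullet> s i" by (simp add: inner_diff_left)
      qed
      also have "\<bar>\<dots>\<bar> \<le> (\<Sum>i\<in>I. \<bar>(x - projector (U i) x) \<bullet> s i\<bar>)" by (rule sum_abs)
      also have "\<dots> \<le> (\<Sum>i\<in>I. norm (s i))"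
      proof (rule sum_mono)
        fix i assume i: "i \<in> I"
        have "\<bar>(x - projector (U i) x) \<bullet> s i\<bar> \<le> norm (x - projector (U i) x) * norm (s i)"
          by (rule Cauchy_Schwarz_ineq2)
        also have "\<dots> \<le> 1 * norm (s i)" using x i by (intro mult_right_mono) (auto simp: X_def)
        finally show "\<bar>(x - projector (U i) x) \<bullet> s i\<bar> \<le> norm (s i)" by simp
      qed
      finally show ?thesis .
    qed
    then show "\<exists>B. \<forall>x\<in>X. \<bar>x \<bullet> y\<bar> \<le> B" by blast
  qed
  then obtain C where C: "C > 0" "\<And>x. x \<in> X \<Longrightarrow> norm x \<le> C" by (auto simp: bounded_pos)
  have "norm x \<le> C * t"
    if x: "x \<in> ?L\<^sup>\<bottom>" and t: "\<And>i. i \<in> I \<Longrightarrow> norm (x - projector (U i) x) \<le> t" and t0: "0 \<le> t" for x t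
  proof (cases "t = 0")
    case True
    then have "x \<in> ?L" using t projector_mem[of "U _" x] U by force
    then have "x \<bullet> x = 0" using x unfolding orthogonal_comp_def orthogonal_def by blast
    then have "x = 0" by simp
    then show ?thesis using True by simp
  next
    case False
    have "(1 / t) *\<^sub>R x \<in> X"
      unfolding X_def
    proof (intro CollectI conjI ballI)
      show "(1 / t) *\<^sub>R x \<in> ?L\<^sup>\<bottom>" using subspace_scale[OF subspace_orthogonal_comp x] .
      fix i assume i: "i \<in> I"
      have eq: "(1 / t) *\<^sub>R x - projector (U i) ((1 / t) *\<^sub>R x) = (1 / t) *\<^sub>R (x - projector (U i) x)"
        using linear_projector[of "U i"] U[OF i] by (simp add: linear_scale scaleR_diff_right)
      then show "norm ((1 / t) *\<^sub>R x - projector (U i) ((1 / t) *\<^sub>R x)) \<le> 1"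
        unfolding eq norm_scaleR using t[OF i] t0 False by (simp add: divide_le_eq_1)
    qed
    then have "norm ((1 / t) *\<^sub>R x) \<le> C" by (rule C(2))
    then show ?thesis using t0 False by (simp add: field_simps)
  qed
  with C(1) show ?thesis using that by blast
qed

section \<open>Products of projections\<close>

lemma compose_ops_Nil [simp]: "compose_ops [] = id"
  by (simp add: compose_ops_def)

lemma compose_ops_snoc [simp]: "compose_ops (Ts @ [T]) = T \<circ> compose_ops Ts"
  by (simp add: compose_ops_def)

lemma compose_ops_append: "compose_ops (Ts @ Ts') = compose_ops Ts' \<circ> compose_ops Ts"
proof (induction Ts' rule: rev_induct)
  case (snoc T Ts')
  then show ?case using compose_ops_snoc[of "Ts @ Ts'" T] by (simp add: comp_assoc del: append_assoc flip: append_assoc)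
qed simp

lemma compose_ops_Cons: "compose_ops (T # Ts) = compose_ops Ts \<circ> T"
  using compose_ops_append[of "[T]" Ts] compose_ops_snoc[of "[]" T] by simp

abbreviation projector_product :: "('i \<Rightarrow> 'a::{real_inner,complete_space} set) \<Rightarrow> 'i list \<Rightarrow> 'a \<Rightarrow> 'a"
  where "projector_product U js \<equiv> compose_ops (map (\<lambda>i. projector (U i)) js)"

lemma bounded_linear_projector_product:
  assumes "\<And>j. j \<in> set js \<Longrightarrow> closed (U j) \<and> subspace (U j)"
  shows "bounded_linear (projector_product U js)"
  using assms
proof (induction js rule: rev_induct)
  case Nil
  show ?case by (simp add: id_def bounded_linear_ident)
next
  case (snoc j js)
  have "bounded_linear (projector (U j))" using snoc.prems[of j] bounded_linear_projector[of "U j"] by simp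
  then show ?case using snoc by (simp add: comp_def bounded_linear_compose)
qed

lemma projector_product_adjoint:
  assumes "\<And>j. j \<in> set js \<Longrightarrow> closed (U j) \<and> subspace (U j)"
  shows "projector_product U js x \<bullet> y = x \<bullet> projector_product U (rev js) y"
  using assms
proof (induction js arbitrary: x)
  case (Cons j js)
  then show ?case
    using projector_self_adjoint[of "U j"] by (simp add: compose_ops_Cons)
qed simp

text \<open>The symmetric product is \<open>A\<^sup>* A\<close> with \<open>A\<close> the product over \<open>js @ [j]\<close>: the last projector of
  \<open>A\<close> is idempotent, so it need not be repeated.\<close>

lemma symmetric_projector_product:
  assumes "\<And>i. i \<in> set (js @ [j]) \<Longrightarrow> closed (U i) \<and> subspace (U i)"
  shows "projector_product U (rev js) (projector_product U (js @ [j]) x) \<bullet> y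
    = projector_product U (js @ [j]) x \<bullet> projector_product U (js @ [j]) y"
proof -
  have j: "closed (U j)" "subspace (U j)" using assms by auto
  let ?a = "projector_product U (js @ [j]) x"
  have "projector_product U (rev js) ?a \<bullet> y = ?a \<bullet> projector_product U js y"
    using projector_product_adjoint[of "rev js" U ?a y] assms by simp
  also have "\<dots> = projector (U j) ?a \<bullet> projector_product U js y"
    using projector_fixes[OF j] projector_mem[OF j] by simp
  also have "\<dots> = ?a \<bullet> projector_product U (js @ [j]) y"
    using projector_self_adjoint[OF j] by simp
  finally show ?thesis .
qed

text \<open>The squared length of each step of the iteration is the decrease of the squared norm in that
  step. So, if little norm is lost in total, every step is short, and \<open>x\<close> is near every subspace.\<close>

lemma projector_product_residual:
  assumes "\<And>j. j \<in> set js \<Longrightarrow> closed (U j) \<and> subspace (U j)"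
  defines "loss \<equiv> \<lambda>js x. (norm x)\<^sup>2 - (norm (projector_product U js x))\<^sup>2"
  shows "0 \<le> loss js x \<and>
    norm (x - projector_product U js x) \<le> real (length js) * sqrt (loss js x) \<and>
    (\<forall>j\<in>set js. norm (x - projector (U j) x) \<le> real (length js) * sqrt (loss js x))"
  using assms(1)
proof (induction js rule: rev_induct)
  case Nil
  show ?case by (simp add: loss_def)
next
  case (snoc j js)
  have j: "closed (U j)" "subspace (U j)" using snoc.prems by auto
  define y where "y = projector_product U js x"
  define z where "z = projector (U j) y"
  have IH: "0 \<le> loss js x" "norm (x - y) \<le> real (length js) * sqrt (loss js x)"
    "\<And>i. i \<in> set js \<Longrightarrow> norm (x - projector (U i) x) \<le> real (length js) * sqrt (loss js x)"
    using snoc by (auto simp: y_def)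
  have yz: "loss (js @ [j]) x = loss js x + (norm (y - z))\<^sup>2"
    using projector_Pythagoras[OF j, of y] by (simp add: loss_def y_def z_def)
  let ?l = "loss (js @ [j]) x"
  have le: "loss js x \<le> ?l" using yz by simp
  have up: "real (length js) * sqrt (loss js x) \<le> real (length js) * sqrt ?l"
    using le by (intro mult_left_mono) auto
  have "norm (y - z) \<le> sqrt ?l" using yz IH(1) by (intro real_le_rsqrt) simp
  then have xz: "norm (x - z) \<le> real (length (js @ [j])) * sqrt ?l"
    using norm_triangle_ineq[of "x - y" "y - z"] IH(2) up by (simp add: algebra_simps)
  have "norm (x - projector (U j) x) \<le> norm (x - z)"
    using projector_nearest[OF j] projector_mem[OF j] z_def by blast
  moreover have "real (length js) * sqrt ?l \<le> real (length (js @ [j])) * sqrt ?l"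
    using le IH(1) by (intro mult_right_mono) auto
  ultimately show ?case
    using xz le IH up by (fastforce simp: y_def z_def)
qed

text \<open>Linear regularity bounds \<open>norm x\<close> by the largest residual, hence by the norm that the product
  loses at \<open>x\<close>.\<close>

lemma onorm_projector_product_less_1:
  fixes U :: "nat \<Rightarrow> 'a::{real_inner,complete_space} set"
  assumes U: "\<And>j. j \<in> set js \<Longrightarrow> closed (U j) \<and> subspace (U j)"
    and cl: "closed (\<Sum>j\<in>set js. (U j)\<^sup>\<bottom>)"
  shows "onorm (projector_product U js \<circ> projector ((\<Inter>j\<in>set js. U j)\<^sup>\<bottom>)) < 1"
proof -
  let ?L = "\<Inter>j\<in>set js. U j" and ?A = "projector_product U js"
  have L: "closed ?L" "subspace ?L" using U by (auto intro!: closed_INT subspace_Inter)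
  obtain C where C: "C > 0"
    "\<And>x t. x \<in> ?L\<^sup>\<bottom> \<Longrightarrow> (\<And>i. i \<in> set js \<Longrightarrow> norm (x - projector (U i) x) \<le> t) \<Longrightarrow> 0 \<le> t
      \<Longrightarrow> norm x \<le> C * t"
    using linear_regularity[OF finite_set U cl] by blast
  \<comment> \<open>The summand 1 guarantees \<open>D \<ge> 1\<close>, so that the square root below is real.\<close>
  define D where "D = 1 + C * real (length js)"
  have D: "D \<ge> 1" using C by (simp add: D_def)
  define q where "q = sqrt (1 - 1 / D\<^sup>2)"
  have D2: "1 \<le> D\<^sup>2" using D by simp
  have q_sq: "q\<^sup>2 = 1 - 1 / D\<^sup>2" using D2 unfolding q_def by (intro real_sqrt_pow2) (simp add: divide_le_eq_1)
  have q: "0 \<le> q" "q < 1" using D D2 by (auto simp: q_def field_simps)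
  have contr: "norm (?A x) \<le> q * norm x" if x: "x \<in> ?L\<^sup>\<bottom>" for x
  proof -
    let ?l = "(norm x)\<^sup>2 - (norm (?A x))\<^sup>2"
    have R: "0 \<le> ?l"
      "\<And>j. j \<in> set js \<Longrightarrow> norm (x - projector (U j) x) \<le> real (length js) * sqrt ?l"
      using projector_product_residual[of js U x] U by auto
    have "norm x \<le> C * (real (length js) * sqrt ?l)"
      using C(2)[OF x R(2)] R(1) by simp
    also have "\<dots> \<le> D * sqrt ?l"
      unfolding D_def mult.assoc[symmetric] using R(1) by (intro mult_right_mono) auto
    finally have "(norm x)\<^sup>2 \<le> (D * sqrt ?l)\<^sup>2" by (intro power_mono) auto
    also have "\<dots> = D\<^sup>2 * ?l" using R(1) by (simp add: power_mult_distrib)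
    finally have "(norm (?A x))\<^sup>2 \<le> (1 - 1 / D\<^sup>2) * (norm x)\<^sup>2"
      using D D2 by (simp add: field_simps)
    also have "\<dots> = (q * norm x)\<^sup>2"
      using q_sq by (simp add: power_mult_distrib)
    finally show ?thesis by (rule power2_le_imp_le) (use q in auto)
  qed
  have "onorm (?A \<circ> projector (?L\<^sup>\<bottom>)) \<le> q"
  proof (rule onorm_bound[OF q(1)])
    fix x
    have mem: "projector (?L\<^sup>\<bottom>) x \<in> ?L\<^sup>\<bottom>"
      unfolding projector_orthogonal_comp[OF L] by (rule projector_residual_mem[OF L])
    have "norm (projector (?L\<^sup>\<bottom>) x) \<le> norm x"
      unfolding projector_orthogonal_comp[OF L]
      using projector_nearest[OF L subspace_0[OF L(2)], of x] by simp
    then show "norm ((?A \<circ> projector (?L\<^sup>\<bottom>)) x) \<le> q * norm x"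
      using contr[OF mem] q(1) by (auto intro: order_trans mult_left_mono)
  qed
  with q(2) show ?thesis by simp
qed

section \<open>Circumcenters\<close>

lemma orthogonal_projection_span_finite:
  fixes x :: "'a::real_inner"
  assumes "finite B"
  shows "\<exists>p\<in>span B. \<forall>v\<in>span B. (x - p) \<bullet> v = 0"
  using assms
proof (induction B arbitrary: x)
  case (insert b B)
  obtain c where c: "c \<in> span B" "\<forall>v\<in>span B. (b - c) \<bullet> v = 0" using insert.IH by blast
  obtain p where p: "p \<in> span B" "\<forall>v\<in>span B. (x - p) \<bullet> v = 0" using insert.IH by blast
  \<comment> \<open>One step of the Gram-Schmidt process; if \<open>d = 0\<close>, then \<open>t = 0\<close> by division by zero.\<close>
  define d where "d = b - c"
  define t where "t = (x \<bullet> d) / (d \<bullet> d)"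
  have t: "t * (d \<bullet> d) = x \<bullet> d" by (simp add: t_def)
  have sub: "span B \<subseteq> span (insert b B)" by (rule span_mono) blast
  have "d \<in> span (insert b B)"
    unfolding d_def using c(1) sub by (intro span_diff) (auto intro: span_base)
  then have "p + t *\<^sub>R d \<in> span (insert b B)"
    using p(1) sub by (intro span_add span_scale) auto
  moreover have "(x - (p + t *\<^sub>R d)) \<bullet> v = 0" if v: "v \<in> span (insert b B)" for v
  proof -
    obtain k where k: "v - k *\<^sub>R b \<in> span B" using v by (auto simp: span_breakdown_eq)
    define u where "u = v - k *\<^sub>R b + k *\<^sub>R c"
    have u: "u \<in> span B" unfolding u_def using k c(1) by (intro span_add span_scale)
    have v_eq: "v = u + k *\<^sub>R d" by (simp add: u_def d_def algebra_simps)
    have "d \<bullet> u = 0" "d \<bullet> p = 0" "(x - p) \<bullet> u = 0" using c p u by (auto simp: d_def)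
    then show ?thesis using t
      by (simp add: v_eq algebra_simps inner_commute)
  qed
  ultimately show ?case by blast
qed simp

lemma orthogonal_projection_affine_hull_finite:
  fixes z :: "'a::real_inner"
  assumes "finite A" and "A \<noteq> {}"
  shows "\<exists>p\<in>affine hull A. \<forall>w\<in>affine hull A. (z - p) \<bullet> (w - p) = 0"
proof -
  obtain a where a: "a \<in> A" using assms by blast
  let ?B = "(\<lambda>x. - a + x) ` (A - {a})"
  have hull: "affine hull A = (\<lambda>x. a + x) ` span ?B" using affine_hull_span2[OF a] .
  obtain p where p: "p \<in> span ?B" "\<forall>v\<in>span ?B. (z - a - p) \<bullet> v = 0"
    using orthogonal_projection_span_finite[of ?B "z - a"] assms by auto
  have "(z - (a + p)) \<bullet> (a + v - (a + p)) = 0" if "v \<in> span ?B" for v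
  proof -
    have "(z - a - p) \<bullet> (v - p) = 0" using p(2) span_diff[OF that p(1)] by blast
    then show ?thesis by (simp add: diff_diff_eq)
  qed
  then show ?thesis unfolding hull using p(1) by blast
qed

text \<open>If \<open>z\<close> is equidistant from the points \<open>T x\<close>, then by Pythagoras so is the projection of \<open>z\<close> onto
  their affine hull. No other point \<open>q\<close> of the hull is: the difference of two points equidistant from
  all the \<open>T x\<close> is orthogonal to every direction of the hull.\<close>

lemma circumcenter_eq_projection:
  fixes S :: "('a::{real_inner,complete_space} \<Rightarrow> 'a) set"
  assumes "finite S" and "S \<noteq> {}" and z: "\<And>T. T \<in> S \<Longrightarrow> dist z (T x) = r"
  defines "H \<equiv> affine hull ((\<lambda>T. T x) ` S)"
  shows "circumcenter_map S x \<in> H \<and>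
    (\<forall>w\<in>H. (z - circumcenter_map S x) \<bullet> (w - circumcenter_map S x) = 0)"
proof -
  obtain p where p: "p \<in> H" "\<forall>w\<in>H. (z - p) \<bullet> (w - p) = 0"
    using orthogonal_projection_affine_hull_finite[of "(\<lambda>T. T x) ` S" z] assms(1,2)
    unfolding H_def by auto
  have TH: "T x \<in> H" if "T \<in> S" for T unfolding H_def using that by (intro hull_inc) auto
  have "(dist p (T x))\<^sup>2 = r\<^sup>2 - (dist z p)\<^sup>2" if "T \<in> S" for T
  proof -
    have "(z - p) \<bullet> (T x - p) = 0" using p TH that by blast
    then have "(dist z (T x))\<^sup>2 = (dist z p)\<^sup>2 + (dist p (T x))\<^sup>2"
      unfolding dist_norm power2_norm_eq_inner by (simp add: inner_commute algebra_simps)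
    then show ?thesis using z[OF that] by simp
  qed
  then have equi: "\<forall>T\<in>S. \<forall>T'\<in>S. dist p (T x) = dist p (T' x)"
    by (metis power2_eq_imp_eq zero_le_dist)
  have "circumcenter_map S x = p"
    unfolding circumcenter_map_def H_def[symmetric]
  proof (rule the_equality)
    show "p \<in> H \<and> (\<forall>T\<in>S. \<forall>T'\<in>S. dist p (T x) = dist p (T' x))" using p equi by blast
    fix q assume q: "q \<in> H \<and> (\<forall>T\<in>S. \<forall>T'\<in>S. dist q (T x) = dist q (T' x))"
    obtain T0 where T0: "T0 \<in> S" using assms(2) by blast
    have "(q - p) \<bullet> T x = (q - p) \<bullet> T0 x" if T: "T \<in> S" for T
    proof -
      have "(dist q (T x))\<^sup>2 = (dist q (T0 x))\<^sup>2" "(dist p (T x))\<^sup>2 = (dist p (T0 x))\<^sup>2"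
        using q equi T T0 by metis+
      then show ?thesis
        unfolding dist_norm power2_norm_eq_inner by (simp add: inner_commute algebra_simps)
    qed
    then have "H \<subseteq> {w. (q - p) \<bullet> w = (q - p) \<bullet> T0 x}"
      unfolding H_def by (intro hull_minimal affine_hyperplane) auto
    then have "(q - p) \<bullet> q = (q - p) \<bullet> T0 x" "(q - p) \<bullet> p = (q - p) \<bullet> T0 x" using q p(1) by blast+
    then have "(q - p) \<bullet> (q - p) = 0" by (simp add: inner_diff_right)
    then show "q = p" by simp
  qed
  with p show ?thesis by simp
qed

definition linear_isometry_fixing :: "'a::real_inner set \<Rightarrow> ('a \<Rightarrow> 'a) \<Rightarrow> bool"
  where "linear_isometry_fixing L T \<longleftrightarrow>
    linear T \<and> (\<forall>x. norm (T x) = norm x) \<and> (\<forall>z\<in>L. T z = z)"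

lemma inner_linear_isometry:
  assumes "linear T" and "\<And>x. norm (T x) = norm x"
  shows "T x \<bullet> T y = x \<bullet> (y :: 'a::real_inner)"
proof -
  have "(norm (T x + T y))\<^sup>2 = (norm (x + y))\<^sup>2"
    using assms by (simp flip: linear_add)
  moreover have "(norm (T x))\<^sup>2 = (norm x)\<^sup>2" "(norm (T y))\<^sup>2 = (norm y)\<^sup>2" using assms by auto
  ultimately show ?thesis
    unfolding power2_norm_eq_inner by (simp add: algebra_simps inner_commute)
qed

text \<open>Isometries that fix \<open>L\<close> move every point orthogonally to \<open>L\<close>, and being displaced from \<open>x\<close>
  orthogonally to \<open>L\<close> is an affine condition.\<close>

lemma inner_affine_hull_orbit:
  assumes S: "\<And>T. T \<in> S \<Longrightarrow> linear_isometry_fixing L T"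
    and w: "w \<in> affine hull ((\<lambda>T. T x) ` S)" and z: "z \<in> L"
  shows "z \<bullet> w = z \<bullet> x"
proof -
  have "z \<bullet> T x = z \<bullet> x" if "T \<in> S" for T
    using inner_linear_isometry[of T z x] S[OF that] z by (simp add: linear_isometry_fixing_def)
  then have "affine hull ((\<lambda>T. T x) ` S) \<subseteq> {w. z \<bullet> w = z \<bullet> x}"
    by (intro hull_minimal affine_hyperplane) auto
  with w show ?thesis by blast
qed

text \<open>\<open>projector L x\<close> is a common fixed point of the isometries, so it is equidistant from the points
  \<open>T x\<close>, and the circumcenter is its best approximation in their affine hull.\<close>

lemma circumcenter_map_isometries:
  fixes S :: "('a::{real_inner,complete_space} \<Rightarrow> 'a) set"
  assumes L: "closed L" "subspace L" and "finite S" and "S \<noteq> {}"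
    and S: "\<And>T. T \<in> S \<Longrightarrow> linear_isometry_fixing L T"
  shows projector_circumcenter_map: "projector L (circumcenter_map S x) = projector L x" (is ?A)
    and circumcenter_map_nearest: "w \<in> affine hull ((\<lambda>T. T x) ` S) \<Longrightarrow>
      norm (circumcenter_map S x - projector L x) \<le> norm (w - projector L x)"
proof -
  let ?c = "circumcenter_map S x" and ?z = "projector L x" and ?H = "affine hull ((\<lambda>T. T x) ` S)"
  have "dist ?z (T x) = norm (?z - x)" if "T \<in> S" for T
    using S[OF that] projector_mem[OF L, of x] unfolding linear_isometry_fixing_def dist_norm
    by (metis linear_diff)
  then have c: "?c \<in> ?H" "\<forall>w\<in>?H. (?z - ?c) \<bullet> (w - ?c) = 0"
    using circumcenter_eq_projection[OF assms(3,4)] by blast+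
  show ?A
  proof (rule projector_eqI[OF L(2)])
    show "?z \<in> L" using projector_mem[OF L] .
    fix v assume v: "v \<in> L"
    have "v \<bullet> ?c = v \<bullet> x" using inner_affine_hull_orbit[OF S c(1) v] .
    then show "(?c - ?z) \<bullet> v = 0"
      using projector_residual_orthogonal[OF L v, of x] by (simp add: inner_commute algebra_simps)
  qed
  show "norm (?c - ?z) \<le> norm (w - ?z)" if "w \<in> ?H"
  proof -
    have "(?z - ?c) \<bullet> (w - ?c) = 0" using c that by blast
    then have "(norm (w - ?z))\<^sup>2 = (norm (?c - ?z))\<^sup>2 + (norm (w - ?c))\<^sup>2"
      unfolding power2_norm_eq_inner by (simp add: inner_commute algebra_simps)
    then show ?thesis by (auto intro: power2_le_imp_le)
  qed
qed

section \<open>Compositions of reflectors\<close>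

lemma linear_isometry_fixing_reflectors:
  assumes "\<And>j. j \<in> set js \<Longrightarrow> closed (U j) \<and> subspace (U j) \<and> L \<subseteq> U j"
  shows "linear_isometry_fixing L (compose_ops (map (\<lambda>j. reflector (U j)) js))"
  using assms
proof (induction js rule: rev_induct)
  case Nil
  show ?case by (simp add: linear_isometry_fixing_def linear_id[unfolded id_def])
next
  case (snoc j js)
  have "linear_isometry_fixing L (compose_ops (map (\<lambda>j. reflector (U j)) js))"
    using snoc by auto
  then show ?case
    using linear_reflector[of "U j"] norm_reflector[of "U j"] reflector_fixes[of "U j"] snoc.prems[of j]
    by (auto simp: linear_isometry_fixing_def linear_compose[unfolded comp_def])
qed

lemma id_in_Psi_ops: "id \<in> Psi_ops m U"
  unfolding Psi_ops_def by (rule CollectI, rule exI[of _ "[]"]) simp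

text \<open>Expanding every factor of the product as the mean of the identity and a reflector writes it as
  an average over all increasing index words.\<close>

lemma projector_product_in_affine_hull_Psi:
  fixes U :: "nat \<Rightarrow> 'a::{real_inner,complete_space} set"
  assumes "\<And>j. j \<in> {1..m} \<Longrightarrow> closed (U j) \<and> subspace (U j)"
  shows "projector_product U [1..<Suc m] x \<in> affine hull ((\<lambda>T. T x) ` Psi_ops m U)"
  using assms
proof (induction m)
  case 0
  have "id x \<in> (\<lambda>T. T x) ` Psi_ops 0 U" using id_in_Psi_ops by (rule imageI)
  then show ?case by (simp add: hull_inc)
next
  case (Suc m)
  let ?j = "Suc m" and ?orb = "\<lambda>m. (\<lambda>T. T x) ` Psi_ops m U"
  have j: "closed (U ?j)" "subspace (U ?j)" using Suc.prems[of ?j] by auto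
  define y where "y = projector_product U [1..<Suc m] x"
  have y: "y \<in> affine hull ?orb m" unfolding y_def using Suc by auto
  have "Psi_ops m U \<subseteq> Psi_ops (Suc m) U" by (force simp: Psi_ops_def)
  then have y': "y \<in> affine hull ?orb (Suc m)" using y hull_mono[of "?orb m" "?orb (Suc m)"] by auto
  have "reflector (U ?j) ` ?orb m \<subseteq> ?orb (Suc m)"
  proof clarify
    fix T assume "T \<in> Psi_ops m U"
    then obtain js where js: "T = compose_ops (map (\<lambda>i. reflector (U i)) js)" "length js \<le> m"
      "set js \<subseteq> {1..m}" "sorted_wrt (<) js" by (auto simp: Psi_ops_def)
    have "compose_ops (map (\<lambda>i. reflector (U i)) (js @ [?j])) \<in> Psi_ops (Suc m) U"
      unfolding Psi_ops_def
      by (rule CollectI, rule exI[of _ "js @ [?j]"]) (use js in \<open>auto simp: sorted_wrt_append less_Suc_eq_le\<close>)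
    then have "reflector (U ?j) \<circ> T \<in> Psi_ops (Suc m) U" by (simp add: js(1))
    then have "(reflector (U ?j) \<circ> T) x \<in> ?orb (Suc m)" by (rule imageI)
    then show "reflector (U ?j) (T x) \<in> ?orb (Suc m)" by simp
  qed
  moreover have "reflector (U ?j) y \<in> affine hull (reflector (U ?j) ` ?orb m)"
    using affine_hull_linear_image[OF bounded_linear_reflector[OF j], of "?orb m"] y by blast
  ultimately have ry: "reflector (U ?j) y \<in> affine hull ?orb (Suc m)"
    using hull_mono[of "reflector (U ?j) ` ?orb m" "?orb (Suc m)"] by blast
  have "projector_product U [1..<Suc (Suc m)] x = projector (U ?j) y" by (simp add: y_def)
  also have "\<dots> = (1/2) *\<^sub>R y + (1/2) *\<^sub>R reflector (U ?j) y"
    by (simp add: reflector_def scaleR_diff_right)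
  also have "\<dots> \<in> affine hull ?orb (Suc m)"
    using y' ry by (intro mem_affine) (auto simp: affine_affine_hull)
  finally show ?case .
qed

section \<open>The convergence rate\<close>

theorem corollary6p7:
  fixes n m :: nat
    and U :: "nat \<Rightarrow> 'a::{real_inner,complete_space} set"
    and S :: "('a \<Rightarrow> 'a) set"
    and \<gamma> :: real
  assumes "n \<noteq> 0" and "m = 2 * n - 1"
    and "\<forall>i\<in>{1..n}. closed (U i) \<and> subspace (U i)"
    and "closed (\<Sum>i\<in>{1..n}. (U i)\<^sup>\<bottom>)"
    and "\<forall>i\<in>{1..n - 1}. U (n + i) = U (n - i)"
    and "finite S" and "Psi_ops m U \<subseteq> S" and "S \<subseteq> Omega_ops m U"
    and "\<gamma> = onorm (compose_ops (map (\<lambda>i. projector (U i)) [1..<Suc n])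
                 \<circ> projector ((\<Inter>i\<in>{1..n}. U i)\<^sup>\<bottom>))"
  shows "\<gamma> \<in> {0..<1} \<and>
    (\<forall>x. \<forall>k. norm ((circumcenter_map S ^^ k) x - projector (\<Inter>i\<in>{1..n}. U i) x)
         \<le> \<gamma> ^ (2 * k) * norm (x - projector (\<Inter>i\<in>{1..n}. U i) x)) \<and>
    (\<forall>x. (\<lambda>k. (circumcenter_map S ^^ k) x) \<longlonglongrightarrow> projector (\<Inter>i\<in>{1..n}. U i) x)"
proof -
  define L where "L = (\<Inter>i\<in>{1..n}. U i)"
  have L: "closed L" "subspace L" using assms(3) by (auto simp: L_def intro!: closed_INT subspace_Inter)
  have um: "closed (U i) \<and> subspace (U i) \<and> L \<subseteq> U i" if i: "i \<in> {1..m}" for i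
  proof (cases "i \<le> n")
    case True
    then show ?thesis using assms(3) i by (auto simp: L_def)
  next
    case False
    then have "i - n \<in> {1..n - 1}" using i assms(2) by auto
    then have "U (n + (i - n)) = U (n - (i - n))" using assms(5) by blast
    moreover have "n - (i - n) \<in> {1..n}" using False i assms(2) by auto
    ultimately show ?thesis using assms(3) False by (auto simp: L_def)
  qed
  let ?A = "projector_product U [1..<Suc n]"
  let ?B = "projector_product U (rev [1..<n])"
  have up_n: "[1..<Suc n] = [1..<n] @ [n]" using assms(1) by simp
  have set_n: "set [1..<Suc n] = {1..n}" by auto
  \<comment> \<open>The indices \<open>n + 1, \<dots>, 2 n - 1\<close> run through \<open>U\<^sub>n\<^sub>-\<^sub>1, \<dots>, U\<^sub>1\<close>.\<close>
  have symm: "projector_product U [1..<Suc m] = ?B \<circ> ?A"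
  proof -
    have "[1..<Suc m] = [1..<Suc n] @ [Suc n..<2 * n]"
      using assms(1,2) upt_add_eq_append[of 1 "Suc n" "n - 1"] by (simp add: mult_2)
    moreover have "map (\<lambda>i. projector (U i)) [Suc n..<2 * n] = map (\<lambda>i. projector (U i)) (rev [1..<n])"
    proof (rule nth_equalityI)
      fix k assume "k < length (map (\<lambda>i. projector (U i)) [Suc n..<2 * n])"
      then have k: "k < n - 1" by simp
      then have "Suc k \<in> {1..n - 1}" by auto
      then have "U (n + Suc k) = U (n - Suc k)" using assms(5) by blast
      then show "map (\<lambda>i. projector (U i)) [Suc n..<2 * n] ! k
          = map (\<lambda>i. projector (U i)) (rev [1..<n]) ! k"
        using k by (simp add: rev_nth Suc_diff_Suc)
    qed simp
    ultimately show ?thesis by (simp only: map_append compose_ops_append)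
  qed
  have PA: "bounded_linear ?A" using assms(3) by (intro bounded_linear_projector_product) auto
  have PL: "projector (L\<^sup>\<bottom>) = (\<lambda>x. x - projector L x)"
    using projector_orthogonal_comp[OF L] by blast
  have bl: "bounded_linear (?A \<circ> projector (L\<^sup>\<bottom>))"
    unfolding PL comp_def
    by (intro bounded_linear_compose[OF PA] bounded_linear_sub bounded_linear_ident
        bounded_linear_projector[OF L])
  have g: "\<gamma> = onorm (?A \<circ> projector (L\<^sup>\<bottom>))" using assms(9) by (simp add: L_def)
  have g0: "0 \<le> \<gamma>" unfolding g using bl by (rule onorm_pos_le)
  have g1: "\<gamma> < 1"
    using onorm_projector_product_less_1[of "[1..<Suc n]" U] assms(3,4) unfolding g L_def set_n by blast
  have A: "norm (?A v) \<le> \<gamma> * norm v" if "v \<in> L\<^sup>\<bottom>" for v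
  proof -
    have "projector L v = 0"
      using that by (intro projector_eqI[OF L(2)])
        (auto simp: subspace_0[OF L(2)] orthogonal_comp_def orthogonal_def inner_commute)
    then show ?thesis using onorm[OF bl, of v] by (simp add: g PL)
  qed
  have S: "linear_isometry_fixing L T" if "T \<in> S" for T
    using that assms(8) linear_isometry_fixing_reflectors[of _ U L] um unfolding Omega_ops_def by blast
  have "S \<noteq> {}" using id_in_Psi_ops assms(7) by blast
  note cc = circumcenter_map_isometries[OF L assms(6) this S]
  have BA: "?B (?A x) \<in> affine hull ((\<lambda>T. T x) ` S)" for x
  proof -
    have "projector_product U [1..<Suc m] x \<in> affine hull ((\<lambda>T. T x) ` Psi_ops m U)"
      using um by (intro projector_product_in_affine_hull_Psi) auto
    moreover have "affine hull ((\<lambda>T. T x) ` Psi_ops m U) \<subseteq> affine hull ((\<lambda>T. T x) ` S)"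
      using assms(7) by (intro hull_mono) auto
    ultimately show ?thesis unfolding symm by auto
  qed
  have contr: "norm (?B (?A v)) \<le> \<gamma>\<^sup>2 * norm v" if v: "v \<in> L\<^sup>\<bottom>" for v
  proof -
    let ?w = "?B (?A v)"
    have w: "?w \<in> L\<^sup>\<bottom>"
      using inner_affine_hull_orbit[OF S BA] v by (simp add: orthogonal_comp_def orthogonal_def)
    \<comment> \<open>The bound for \<open>A\<close> applies to both factors, since \<open>w\<close> also lies in \<open>L\<^sup>\<bottom>\<close>.\<close>
    have "norm ?w * norm ?w = ?w \<bullet> ?w" by (simp flip: power2_norm_eq_inner power2_eq_square)
    also have "\<dots> = ?A v \<bullet> ?A ?w"
      unfolding up_n by (rule symmetric_projector_product) (use assms(1,3) in auto)
    also have "\<dots> \<le> norm (?A v) * norm (?A ?w)" by (rule norm_cauchy_schwarz)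
    also have "\<dots> \<le> (\<gamma> * norm v) * (\<gamma> * norm ?w)" using A[OF v] A[OF w] g0 by (intro mult_mono) auto
    finally have "norm ?w * norm ?w \<le> (\<gamma>\<^sup>2 * norm v) * norm ?w" by (simp add: power2_eq_square mult_ac)
    then show ?thesis by (cases "norm ?w = 0") (auto simp: mult_le_cancel_right)
  qed
  have step: "norm (circumcenter_map S y - projector L y) \<le> \<gamma>\<^sup>2 * norm (y - projector L y)" for y
  proof -
    let ?z = "projector L y"
    have z: "?z \<in> U i" if "i \<in> {1..m}" for i using um[OF that] projector_mem[OF L] by blast
    have "?B (?A y) - ?z = ?B (?A (y - ?z))"
    proof -
      have lin: "linear (?B \<circ> ?A)"
        unfolding symm[symmetric]
        by (intro bounded_linear.linear bounded_linear_projector_product) (use um in auto)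
      have "projector_product U js ?z = ?z" if "set js \<subseteq> {1..m}" for js
        using that
      proof (induction js rule: rev_induct)
        case (snoc j js)
        then show ?case using um[of j] z[of j] projector_fixes[of "U j" ?z] by simp
      qed simp
      moreover have "set [1..<Suc m] \<subseteq> {1..m}" by auto
      ultimately have "projector_product U [1..<Suc m] ?z = ?z" by blast
      then have "(?B \<circ> ?A) ?z = ?z" unfolding symm .
      then show ?thesis using linear_diff[OF lin, of y ?z] by simp
    qed
    moreover have "y - ?z \<in> L\<^sup>\<bottom>" by (rule projector_residual_mem[OF L])
    ultimately have "norm (?B (?A y) - ?z) \<le> \<gamma>\<^sup>2 * norm (y - ?z)" using contr by simp
    moreover have "norm (circumcenter_map S y - ?z) \<le> norm (?B (?A y) - ?z)"
      by (rule cc(2)[OF _ BA])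
    ultimately show ?thesis by (rule order_trans[rotated])
  qed
  have iter: "projector L ((circumcenter_map S ^^ k) x) = projector L x \<and>
      norm ((circumcenter_map S ^^ k) x - projector L x) \<le> \<gamma> ^ (2 * k) * norm (x - projector L x)" for x k
  proof (induction k)
    case (Suc k)
    let ?y = "(circumcenter_map S ^^ k) x"
    have "norm (circumcenter_map S ?y - projector L x) \<le> \<gamma>\<^sup>2 * norm (?y - projector L x)"
      using step[of ?y] Suc by simp
    also have "\<dots> \<le> \<gamma>\<^sup>2 * (\<gamma> ^ (2 * k) * norm (x - projector L x))"
      using Suc by (intro mult_left_mono) auto
    finally show ?case using Suc cc(1) by (simp add: power_add power2_eq_square mult_ac)
  qed simp
  have "(\<lambda>k. (circumcenter_map S ^^ k) x) \<longlonglongrightarrow> projector L x" for x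
  proof (rule Lim_null[THEN iffD2], rule Lim_null_comparison)
    show "\<forall>\<^sub>F k in sequentially. norm ((circumcenter_map S ^^ k) x - projector L x)
        \<le> (\<gamma>\<^sup>2) ^ k * norm (x - projector L x)"
      using iter by (simp add: power_mult)
    have "(\<lambda>k. (\<gamma>\<^sup>2) ^ k) \<longlonglongrightarrow> 0"
      using g0 g1 by (intro LIMSEQ_realpow_zero) (auto simp: power_less_one_iff)
    from tendsto_mult_right[OF this] show "(\<lambda>k. (\<gamma>\<^sup>2) ^ k * norm (x - projector L x)) \<longlonglongrightarrow> 0" by simp
  qed
  with g0 g1 iter show ?thesis unfolding L_def by auto
qed

end
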